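(* Let $t$ be a $\lambda$-term and let $\vec{x} = (x_1, \dots, x_k)$ be a list of pairwise distinct variables with $\mathrm{Fv}(t) \subseteq \{x_1,\dots,x_k\}$. The following are equivalent: (1) $t$ is $\rhd\mathsf{shuf}$-normalizable; (2) $t \simeq_{\mathsf{shuf}} u$ for some $\rhd\mathsf{shuf}$-normal term $u$; (3) $[\![t]\!]_{\vec{x}} \neq \emptyset$; (4) there exists a derivation of $x_1 \colon P_1, \dots, x_k \colon P_k \vdash t \colon Q$ for some positive types $P_1, \dots, P_k, Q$; (5) $t$ is strongly $\rhd\mathsf{shuf}$-normalizable.
   Context: Terms: $t,u,s ::= x \mid \lambda x.t \mid tu$ (up to $\alpha$-conversion); values $v ::= x \mid \lambda x.t$. $\mathrm{Fv}(t)$ is the set of free variables, $t\{v/x\}$ capture-avoiding substitution. Root steps: ($\beta_v$) $(\lambda x.t)v \mapsto t\{v/x\}$ with $v$ a value; ($\sigma_1$) $(\lambda x.t)us \mapsto (\lambda x.ts)u$ if $x \notin \mathrm{Fv}(s)$; ($\sigma_3$) $v((\lambda x.s)u) \mapsto (\lambda x.vs)u$ if $v$ is a value and $x \notin \mathrm{Fv}(v)$. Balanced contexts: $B ::= [\cdot] \mid (\lambda x.B)t \mid Bt \mid tB$. For a root step $r$, the $\rhd r$-reduction is its closure under balanced contexts and the $r$-reduction is its closure under arbitrary contexts (also under $\lambda$). The $\rhd\mathsf{shuf}$-reduction is the union of $\rhd\beta_v$, $\rhd\sigma_1$, $\rhd\sigma_3$-reductions; $\mathsf{shuf}$-reduction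 is the union of $\beta_v$, $\sigma_1$, $\sigma_3$-reductions, and $\simeq_{\mathsf{shuf}}$ is its reflexive-symmetric-transitive closure. A term is $\rhd\mathsf{shuf}$-normal if no $\rhd\mathsf{shuf}$-step applies to it, $\rhd\mathsf{shuf}$-normalizable if it reduces in finitely many steps to a $\rhd\mathsf{shuf}$-normal term, strongly normalizable if there is no infinite reduction sequence from it. Types: positive types are finite multisets $[(P_1,Q_1),\dots,(P_n,Q_n)]$ ($n\ge 0$) of pairs of positive types; $\mathbf{0}$ denotes the empty multiset and $\uplus$ multiset union. An environment $\Gamma$ maps variables to positive types, with $\mathrm{Dom}(\Gamma)=\{x : \Gamma(x)\neq\mathbf{0}\}$ finite; $\Gamma \uplus \Delta$ is pointwise union; $\Gamma, x\colon P$ requires $x \notin \mathrm{Dom}(\Gamma)$; unlisted variables have type $\mathbf{0}$. Typing rules: (ax) $x\colon P \vdash x \colon P$; ($\lambda$) from $\Gamma_i, x\colon P_i \vdash t \colon Q_i$ for $1\le i\le n$ ($n \geq 0$) infer $\biguplus_i \Gamma_i \vdash \lambda x.t \colon [(P_1,Q_1),\dots,(P_n,Q_n)]$; ($@$) from $\Gamma \vdash t \colon [(P,Q)]$ and $\Delta \vdash u \colon P$ infer $\Gamma\uplus\Delta \vdash tu \colon Q$. For a list $\vec{x}=(x_1,\dots,x_k)$ of pairwise distinct variables containing $\mathrm{Fv}(t)$, the relational semantics is $[\![t]\!]_{\vec{x}} = \{((P_1,\dots,P_k),Q) \mid x_1\colon P_1,\dots,x_k\colon P_k \vdash t \colon Q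 \text{ is derivable}\}$. *)

theory Defs
  imports "HOL-Library.Multiset"
begin

text \<open>
  Terms up to \<open>\<alpha>\<close>-conversion are de Bruijn terms. Variables are natural numbers; the free
  variables of a term are the indices that are dangling at the root, renumbered relative to it.
\<close>

datatype trm = Var nat | Lam trm | App trm trm

inductive is_value :: "trm \<Rightarrow> bool" where
  "is_value (Var x)"
| "is_value (Lam t)"

primrec Fv :: "trm \<Rightarrow> nat set" where
  "Fv (Var x) = {x}"
| "Fv (Lam t) = {x. Suc x \<in> Fv t}"
| "Fv (App t u) = Fv t \<union> Fv u"

primrec lift :: "nat \<Rightarrow> trm \<Rightarrow> trm" where
  "lift k (Var i) = (if i < k then Var i else Var (Suc i))"
| "lift k (Lam t) = Lam (lift (Suc k) t)"
| "lift k (App t u) = App (lift k t) (lift k u)"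

text \<open>\<open>subst t s k\<close> replaces the index \<open>k\<close> by \<open>s\<close> and decrements the indices above \<open>k\<close>,
  because the binder of \<open>k\<close> disappears.\<close>

primrec subst :: "trm \<Rightarrow> trm \<Rightarrow> nat \<Rightarrow> trm" where
  "subst (Var i) s k = (if k < i then Var (i - 1) else if i = k then s else Var i)"
| "subst (Lam t) s k = Lam (subst t (lift 0 s) (Suc k))"
| "subst (App t u) s k = App (subst t s k) (subst u s k)"

text \<open>
  In \<open>sigma1\<close> and \<open>sigma3\<close>, the term that moves under the binder is lifted: this is the
  side condition that the bound variable is not free in it.
\<close>

inductive beta_v :: "trm \<Rightarrow> trm \<Rightarrow> bool" where
  "is_value v \<Longrightarrow> beta_v (App (Lam t) v) (subst t v 0)"

inductive sigma1 :: "trm \<Rightarrow> trm \<Rightarrow> bool" where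
  "sigma1 (App (App (Lam t) u) s) (App (Lam (App t (lift 0 s))) u)"

inductive sigma3 :: "trm \<Rightarrow> trm \<Rightarrow> bool" where
  "is_value v \<Longrightarrow> sigma3 (App v (App (Lam s) u)) (App (Lam (App (lift 0 v) s)) u)"

datatype ctx = Hole | CLam ctx | CAppL ctx trm | CAppR trm ctx

primrec plug :: "ctx \<Rightarrow> trm \<Rightarrow> trm" where
  "plug Hole s = s"
| "plug (CLam C) s = Lam (plug C s)"
| "plug (CAppL C t) s = App (plug C s) t"
| "plug (CAppR t C) s = App t (plug C s)"

inductive balanced :: "ctx \<Rightarrow> bool" where
  "balanced Hole"
| "balanced B \<Longrightarrow> balanced (CAppL (CLam B) t)"
| "balanced B \<Longrightarrow> balanced (CAppL B t)"
| "balanced B \<Longrightarrow> balanced (CAppR t B)"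

inductive red :: "(trm \<Rightarrow> trm \<Rightarrow> bool) \<Rightarrow> trm \<Rightarrow> trm \<Rightarrow> bool" for r where
  "r s s' \<Longrightarrow> red r (plug C s) (plug C s')"

inductive bal_red :: "(trm \<Rightarrow> trm \<Rightarrow> bool) \<Rightarrow> trm \<Rightarrow> trm \<Rightarrow> bool" for r where
  "balanced B \<Longrightarrow> r s s' \<Longrightarrow> bal_red r (plug B s) (plug B s')"

definition shuf :: "trm \<Rightarrow> trm \<Rightarrow> bool" where
  "shuf t u \<longleftrightarrow> red beta_v t u \<or> red sigma1 t u \<or> red sigma3 t u"

definition bal_shuf :: "trm \<Rightarrow> trm \<Rightarrow> bool" where
  "bal_shuf t u \<longleftrightarrow> bal_red beta_v t u \<or> bal_red sigma1 t u \<or> bal_red sigma3 t u"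

abbreviation shuf_equiv :: "trm \<Rightarrow> trm \<Rightarrow> bool" (infix "\<simeq>\<^sub>s\<^sub>h\<^sub>u\<^sub>f" 50) where
  "t \<simeq>\<^sub>s\<^sub>h\<^sub>u\<^sub>f u \<equiv> equivclp shuf t u"

definition normal :: "(trm \<Rightarrow> trm \<Rightarrow> bool) \<Rightarrow> trm \<Rightarrow> bool" where
  "normal R t \<longleftrightarrow> (\<nexists>u. R t u)"

definition normalizable :: "(trm \<Rightarrow> trm \<Rightarrow> bool) \<Rightarrow> trm \<Rightarrow> bool" where
  "normalizable R t \<longleftrightarrow> (\<exists>u. R\<^sup>*\<^sup>* t u \<and> normal R u)"

definition strongly_normalizable :: "(trm \<Rightarrow> trm \<Rightarrow> bool) \<Rightarrow> trm \<Rightarrow> bool" where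
  "strongly_normalizable R t \<longleftrightarrow> (\<nexists>f :: nat \<Rightarrow> trm. f 0 = t \<and> (\<forall>i. R (f i) (f (Suc i))))"

datatype ptype = PT (pairs: "(ptype \<times> ptype) multiset")

text \<open>On positive types, \<open>0\<close> is the empty multiset and \<open>+\<close> is multiset union.\<close>

instantiation ptype :: comm_monoid_add
begin

definition zero_ptype :: ptype where
  "0 = PT {#}"

definition plus_ptype :: "ptype \<Rightarrow> ptype \<Rightarrow> ptype" where
  "P + Q = PT (pairs P + pairs Q)"

instance
  by standard (simp_all add: zero_ptype_def plus_ptype_def ac_simps)

end

type_synonym env = "nat \<Rightarrow> ptype"

definition Dom :: "env \<Rightarrow> nat set" where
  "Dom \<Gamma> = {x. \<Gamma> x \<noteq> 0}"

text \<open>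
  Under a binder the bound variable is \<open>0\<close> and \<open>\<Gamma>\<close> is shifted, so \<open>case_nat P \<Gamma>\<close>
  is the environment extended by the bound variable with type \<open>P\<close>. Finiteness of the domain
  is not a premise of the rules: it holds for every derivable judgement
  (\<open>typing_finite_Dom\<close> below).
\<close>

inductive typing :: "env \<Rightarrow> trm \<Rightarrow> ptype \<Rightarrow> bool" ("_ \<turnstile> _ : _" [51, 51, 51] 50) where
  ax: "(\<lambda>y. if y = x then P else 0) \<turnstile> Var x : P"
| lam: "(\<And>i. i < n \<Longrightarrow> case_nat (P i) (\<Gamma> i) \<turnstile> t : Q i) \<Longrightarrow>
    (\<lambda>y. \<Sum>i<n. \<Gamma> i y) \<turnstile> Lam t : PT (mset (map (\<lambda>i. (P i, Q i)) [0..<n]))"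
| app: "\<Gamma> \<turnstile> t : PT {#(P, Q)#} \<Longrightarrow> \<Delta> \<turnstile> u : P \<Longrightarrow> (\<lambda>y. \<Gamma> y + \<Delta> y) \<turnstile> App t u : Q"

lemma typing_finite_Dom: "\<Gamma> \<turnstile> t : Q \<Longrightarrow> finite (Dom \<Gamma>)"
proof (induction rule: typing.induct)
  case (ax x P)
  have "Dom (\<lambda>y. if y = x then P else 0) \<subseteq> {x}"
    by (auto simp: Dom_def)
  then show ?case by (rule finite_subset) simp
next
  case (lam n P \<Gamma> t Q)
  have "finite (Dom (\<Gamma> i))" if "i < n" for i
  proof -
    have "Dom (\<Gamma> i) = Suc -` Dom (case_nat (P i) (\<Gamma> i))"
      by (auto simp: Dom_def)
    then show ?thesis
      using lam.IH[OF that] by (simp add: finite_vimageI)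
  qed
  moreover have "Dom (\<lambda>y. \<Sum>i<n. \<Gamma> i y) \<subseteq> (\<Union>i<n. Dom (\<Gamma> i))"
    by (auto simp: Dom_def intro: ccontr)
  ultimately show ?case by (auto intro: finite_subset)
next
  case (app \<Gamma> t P Q \<Delta> u)
  have "Dom (\<lambda>y. \<Gamma> y + \<Delta> y) \<subseteq> Dom \<Gamma> \<union> Dom \<Delta>"
    by (auto simp: Dom_def)
  then show ?case using app.IH by (auto intro: finite_subset)
qed

definition env_of :: "nat list \<Rightarrow> ptype list \<Rightarrow> env" where
  "env_of xs Ps = (\<lambda>y. case map_of (zip xs Ps) y of None \<Rightarrow> 0 | Some P \<Rightarrow> P)"

definition sem :: "nat list \<Rightarrow> trm \<Rightarrow> (ptype list \<times> ptype) set" where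
  "sem xs t = {(Ps, Q). length Ps = length xs \<and> env_of xs Ps \<turnstile> t : Q}"

end

theory Submission
  imports Defs "HOL-Library.Function_Algebras"
begin

text \<open>
  Call the number of application rules of a derivation its size. A balanced \<open>\<beta>\<^sub>v\<close>-step lowers the
  size of every derivation by one, because the fired redex is not under an unapplied abstraction and
  is hence typed exactly once; \<open>\<sigma>\<close>-steps preserve the size and terminate on their own. So typable
  terms are strongly normalizable. Conversely, typability is invariant under arbitrary
  \<open>shuf\<close>-steps in both directions, and a balanced normal term is typable by induction on its shape.
\<close>

section \<open>Sized derivations\<close>

text \<open>The count leaves axioms and abstraction rules out because substitution cuts and glues
  derivations of the argument. With only applications counted, a value has type \<open>0\<close> at
  no cost, and its derivations at \<open>P + Q\<close> are exactly the sums of one at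
  \<open>P\<close> and one at \<open>Q\<close>, environments and sizes included. Handing the pieces
  of a value to the occurrences of a variable thus conserves the total, and a root
  \<open>beta_v\<close>-step loses just the application of its redex. An application costs at least
  one even at type \<open>0\<close>, so this bookkeeping fails for arguments that are not values.
  The n-ary abstraction rule is traded for an empty rule and a rule that adds one pair, so that
  cutting and gluing become inductions on derivations.\<close>

inductive sized :: "env \<Rightarrow> nat \<Rightarrow> trm \<Rightarrow> ptype \<Rightarrow> bool" where
  sized_Var: "sized (\<lambda>y. if y = x then P else 0) 0 (Var x) P"
| sized_Lam_zero: "sized 0 0 (Lam t) 0"
| sized_Lam_plus: "sized (case_nat P \<Gamma>) n t Q \<Longrightarrow> sized \<Delta> m (Lam t) R \<Longrightarrow>
    sized (\<Gamma> + \<Delta>) (n + m) (Lam t) (PT {#(P, Q)#} + R)"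
| sized_App: "sized \<Gamma> n t (PT {#(P, Q)#}) \<Longrightarrow> sized \<Delta> m u P \<Longrightarrow>
    sized (\<Gamma> + \<Delta>) (Suc (n + m)) (App t u) Q"

inductive_cases sized_VarE: "sized \<Gamma> n (Var x) Q"
inductive_cases sized_LamE: "sized \<Gamma> n (Lam t) Q"
inductive_cases sized_AppE: "sized \<Gamma> n (App t u) Q"

text \<open>The rule induction principle for \<open>sized\<close> eta-expands environments; pushing applications
  into sums would then hide the sums from the simplifier.\<close>

declare zero_fun_apply [simp del] plus_fun_apply [simp del]

lemmas env_apply = zero_fun_apply plus_fun_apply

section \<open>Sums of positive types and of environments\<close>

lemma ptype_add_eq_zero_iff [simp]: "P + Q = 0 \<longleftrightarrow> P = 0 \<and> Q = (0 :: ptype)"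
  by (cases P; cases Q) (auto simp: zero_ptype_def plus_ptype_def)

lemma ptype_zero_eq_add_iff [simp]: "0 = P + Q \<longleftrightarrow> P = 0 \<and> Q = (0 :: ptype)"
  using ptype_add_eq_zero_iff by metis

lemma PT_single_neq_zero [simp]: "PT {#p#} \<noteq> 0"
  by (simp add: zero_ptype_def)

lemma PT_single_eq_single_add_iff:
  "PT {#q#} = PT {#p#} + R \<longleftrightarrow> q = p \<and> R = 0"
  by (cases R) (auto simp: zero_ptype_def plus_ptype_def)

text \<open>When a type is to be split, this decides which part receives the pair added by the last
  \<open>sized_Lam_plus\<close>.\<close>

lemma PT_single_add_eq_addE:
  assumes "PT {#p#} + R = P1 + P2"
  obtains P1' where "P1 = PT {#p#} + P1'" "R = P1' + P2"
    | P2' where "P2 = PT {#p#} + P2'" "R = P1 + P2'"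
proof -
  obtain A where R: "R = PT A" by (cases R)
  obtain B where P1: "P1 = PT B" by (cases P1)
  obtain C where P2: "P2 = PT C" by (cases P2)
  have eq: "add_mset p A = B + C"
    using assms by (simp add: R P1 P2 plus_ptype_def)
  then have "p \<in># B \<or> p \<in># C"
    by (metis union_iff union_single_eq_member)
  then show thesis
  proof
    assume "p \<in># B"
    then obtain B' where "B = add_mset p B'" by (metis insert_DiffM)
    with eq show thesis
      by (intro that(1)[of "PT B'"]) (auto simp: R P1 P2 plus_ptype_def)
  next
    assume "p \<in># C"
    then obtain C' where "C = add_mset p C'" by (metis insert_DiffM)
    with eq show thesis
      by (intro that(2)[of "PT C'"]) (auto simp: R P1 P2 plus_ptype_def)
  qed
qed

lemma case_nat_plus: "case_nat P \<Gamma> + case_nat Q \<Delta> = case_nat (P + Q) (\<Gamma> + \<Delta>)"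
  for \<Gamma> \<Delta> :: env
  by (auto simp: fun_eq_iff env_apply split: nat.split)

lemma case_nat_inject: "case_nat P \<Gamma> = case_nat Q \<Delta> \<longleftrightarrow> P = Q \<and> \<Gamma> = \<Delta>"
  by (auto simp: fun_eq_iff split: nat.splits)

text \<open>Once the single pair is used, the rest of the derivation has type \<open>0\<close> and
  contributes nothing. As functions in applications have singleton types, the body of an applied
  abstraction is typed exactly once.\<close>

lemma sized_Lam_single_iff:
  "sized \<Gamma> n (Lam t) (PT {#(P, Q)#}) \<longleftrightarrow> sized (case_nat P \<Gamma>) n t Q"
proof
  have zero: "\<Delta> = 0 \<and> m = 0" if "sized \<Delta> m (Lam t) 0" for \<Delta> m
    using that by (cases rule: sized_LamE) auto
  assume "sized \<Gamma> n (Lam t) (PT {#(P, Q)#})"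
  then show "sized (case_nat P \<Gamma>) n t Q"
    by (cases rule: sized_LamE) (auto simp: PT_single_eq_single_add_iff dest!: zero)
next
  assume "sized (case_nat P \<Gamma>) n t Q"
  from sized_Lam_plus[OF this sized_Lam_zero]
  show "sized \<Gamma> n (Lam t) (PT {#(P, Q)#})" by simp
qed

section \<open>Erasing, gluing and cutting derivations of values\<close>

lemma sized_value_zero: "is_value v \<Longrightarrow> sized 0 0 v 0"
proof (induction rule: is_value.induct)
  case (1 x)
  show ?case using sized_Var[of x 0] by (simp add: zero_fun_def)
next
  case (2 t)
  show ?case by (rule sized_Lam_zero)
qed

lemma sized_value_zeroD:
  assumes "is_value v" "sized \<Gamma> n v 0"
  shows "\<Gamma> = 0" "n = 0"
proof -
  from assms(1) have "\<Gamma> = 0 \<and> n = 0"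
  proof cases
    case (1 x)
    with assms(2) show ?thesis by (auto simp: fun_eq_iff env_apply elim: sized_VarE)
  next
    case (2 t)
    from assms(2)[unfolded 2] show ?thesis by (cases rule: sized_LamE) auto
  qed
  then show "\<Gamma> = 0" "n = 0" by auto
qed

lemma sized_value_plus:
  assumes v: "is_value v" and P: "sized \<Gamma> n v P" and Q: "sized \<Delta> m v Q"
  shows "sized (\<Gamma> + \<Delta>) (n + m) v (P + Q)"
  using v
proof cases
  case (1 x)
  have "\<Gamma> = (\<lambda>y. if y = x then P else 0)" "n = 0" "\<Delta> = (\<lambda>y. if y = x then Q else 0)" "m = 0"
    using P Q unfolding 1 by (auto elim: sized_VarE)
  moreover from this have "\<Gamma> + \<Delta> = (\<lambda>y. if y = x then P + Q else 0)"
    by (auto simp: fun_eq_iff env_apply)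
  ultimately show ?thesis
    using sized_Var[of x "P + Q"] by (simp add: 1)
next
  case (2 t)
  show ?thesis
    using P Q unfolding 2
  \<comment> \<open>As in appending lists, the pairs of the first derivation are put one by one in
    front of the second.\<close>
  proof (induction \<Gamma> n "Lam t" P rule: sized.induct)
    case sized_Lam_zero
    then show ?case by simp
  next
    case (sized_Lam_plus P \<Gamma> n Q' \<Delta>' m' R)
    from sized.sized_Lam_plus[OF sized_Lam_plus.hyps(1) sized_Lam_plus.hyps(4)[OF sized_Lam_plus.prems]]
    show ?case by (simp add: add.assoc)
  qed
qed

text \<open>This is what duplication of a value needs: two subderivations that use a variable at
  \<open>P\<close> and at \<open>Q\<close> each receive their own piece.\<close>

lemma sized_value_split:
  assumes v: "is_value v" and P: "sized \<Gamma> n v (P + Q)"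
  obtains \<Gamma>1 n1 \<Gamma>2 n2 where "sized \<Gamma>1 n1 v P" "sized \<Gamma>2 n2 v Q" "\<Gamma> = \<Gamma>1 + \<Gamma>2" "n = n1 + n2"
proof -
  from v have "\<exists>\<Gamma>1 n1 \<Gamma>2 n2. sized \<Gamma>1 n1 v P \<and> sized \<Gamma>2 n2 v Q \<and> \<Gamma> = \<Gamma>1 + \<Gamma>2 \<and> n = n1 + n2"
  proof cases
    case (1 x)
    have *: "\<Gamma> = (\<lambda>y. if y = x then P + Q else 0)" "n = 0"
      using P unfolding 1 by (auto elim: sized_VarE)
    show ?thesis
      using sized_Var[of x P] sized_Var[of x Q] unfolding 1 *
      by (intro exI[of _ "\<lambda>y. if y = x then P else 0"] exI[of _ "\<lambda>y. if y = x then Q else 0"]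
          exI[of _ 0]) (auto simp: fun_eq_iff env_apply)
  next
    case (2 t)
    show ?thesis
      using P unfolding 2
    \<comment> \<open>The split is generalized, because the part that owns the first pair shrinks
      when passing to the tail.\<close>
    proof (induction \<Gamma> n "Lam t" "P + Q" arbitrary: P Q rule: sized.induct)
      case sized_Lam_zero
      then have "P = 0" "Q = 0" by (metis ptype_add_eq_zero_iff)+
      then show ?case
        by (metis add_0 sized.sized_Lam_zero)
    next
      case (sized_Lam_plus P' \<Gamma> n Q' \<Delta> m R)
      from sized_Lam_plus.hyps(5) show ?case
      proof (cases rule: PT_single_add_eq_addE)
        case (1 P1)
        obtain \<Gamma>1 n1 \<Gamma>2 n2 where
          *: "sized \<Gamma>1 n1 (Lam t) P1" "sized \<Gamma>2 n2 (Lam t) Q" "\<Delta> = \<Gamma>1 + \<Gamma>2" "m = n1 + n2"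
          using sized_Lam_plus.hyps(4)[OF 1(2)] by blast
        show ?thesis
          using sized.sized_Lam_plus[OF sized_Lam_plus.hyps(1) *(1)] *(2)
          unfolding 1 *(3,4) by (metis add.assoc)
      next
        case (2 P2)
        obtain \<Gamma>1 n1 \<Gamma>2 n2 where
          *: "sized \<Gamma>1 n1 (Lam t) P" "sized \<Gamma>2 n2 (Lam t) P2" "\<Delta> = \<Gamma>1 + \<Gamma>2" "m = n1 + n2"
          using sized_Lam_plus.hyps(4)[OF 2(2)] by blast
        show ?thesis
          using sized.sized_Lam_plus[OF sized_Lam_plus.hyps(1) *(2)] *(1)
          unfolding 2 *(3,4) by (metis add.left_commute)
      qed
    qed
  qed
  then show thesis using that by blast
qed

section \<open>Agreement with \<open>typing\<close>\<close>

lemma sized_imp_typing: "sized \<Gamma> n t Q \<Longrightarrow> \<Gamma> \<turnstile> t : Q"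
proof (induction rule: sized.induct)
  case (sized_Var x P)
  show ?case by (rule typing.ax)
next
  case (sized_Lam_zero t)
  show ?case using typing.lam[of 0] by (simp add: zero_ptype_def zero_fun_def)
next
  case (sized_Lam_plus P \<Gamma> n t Q \<Delta> m R)
  from sized_Lam_plus.IH(2) obtain k Ps \<Gamma>s Qs where
    *: "\<And>i. i < k \<Longrightarrow> case_nat (Ps i) (\<Gamma>s i) \<turnstile> t : Qs i"
    "\<Delta> = (\<lambda>y. \<Sum>i<k. \<Gamma>s i y)" "R = PT (mset (map (\<lambda>i. (Ps i, Qs i)) [0..<k]))"
    by (cases rule: typing.cases) auto
  \<comment> \<open>The new premise is appended at index \<open>k\<close>; the multiset of pairs
    does not see the order.\<close>
  have "case_nat ((Ps(k := P)) i) ((\<Gamma>s(k := \<Gamma>)) i) \<turnstile> t : (Qs(k := Q)) i" if "i < Suc k" for i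
    using that *(1) sized_Lam_plus.IH(1) by (cases "i = k") auto
  from typing.lam[of "Suc k", OF this]
  have "(\<lambda>y. \<Sum>i<Suc k. (\<Gamma>s(k := \<Gamma>)) i y) \<turnstile> Lam t :
    PT (mset (map (\<lambda>i. ((Ps(k := P)) i, (Qs(k := Q)) i)) [0..<Suc k]))" .
  moreover have "(\<lambda>y. \<Sum>i<Suc k. (\<Gamma>s(k := \<Gamma>)) i y) = \<Gamma> + \<Delta>"
    by (auto simp: *(2) fun_eq_iff env_apply add.commute)
  moreover have "PT (mset (map (\<lambda>i. ((Ps(k := P)) i, (Qs(k := Q)) i)) [0..<Suc k])) = PT {#(P, Q)#} + R"
    by (auto simp: *(3) plus_ptype_def intro!: image_mset_cong)
  ultimately show ?case by simp
next
  case (sized_App \<Gamma> n t P Q \<Delta> m u)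
  then show ?case
    unfolding plus_fun_def by (intro typing.app)
qed

lemma typing_imp_sized: "\<Gamma> \<turnstile> t : Q \<Longrightarrow> \<exists>n. sized \<Gamma> n t Q"
proof (induction rule: typing.induct)
  case (ax x P)
  show ?case using sized_Var by blast
next
  case (lam n P \<Gamma> t Q)
  \<comment> \<open>Induction on the prefixes of the family of premises: each step adds the premise
    of index \<open>k\<close> by \<open>sized_Lam_plus\<close>.\<close>
  have "k \<le> n \<Longrightarrow> \<exists>m. sized (\<lambda>y. \<Sum>i<k. \<Gamma> i y) m (Lam t) (PT (mset (map (\<lambda>i. (P i, Q i)) [0..<k])))" for k
  proof (induction k)
    case 0
    show ?case
      using sized_Lam_zero by (auto simp: zero_fun_def zero_ptype_def)
  next
    case (Suc k)
    then obtain m where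
      "sized (\<lambda>y. \<Sum>i<k. \<Gamma> i y) m (Lam t) (PT (mset (map (\<lambda>i. (P i, Q i)) [0..<k])))"
      by auto
    moreover obtain m' where "sized (case_nat (P k) (\<Gamma> k)) m' t (Q k)"
      using lam.IH[of k] Suc.prems by auto
    ultimately show ?case
      using sized_Lam_plus[of "P k" "\<Gamma> k" m' t "Q k"]
      by (fastforce simp: plus_ptype_def plus_fun_def add.commute)
  qed
  then show ?case by blast
next
  case (app \<Gamma> t P Q \<Delta> u)
  then show ?case
    using sized_App unfolding plus_fun_def by blast
qed

lemma typing_iff_sized: "\<Gamma> \<turnstile> t : Q \<longleftrightarrow> (\<exists>n. sized \<Gamma> n t Q)"
  using sized_imp_typing typing_imp_sized by blast

text \<open>There is no weakening: axioms give only their own variable a type and the empty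
  abstraction rule none. Hence an environment is determined by its values on any list that covers
  the free variables.\<close>

lemma sized_eq_zero_outside_Fv: "sized \<Gamma> n t Q \<Longrightarrow> x \<notin> Fv t \<Longrightarrow> \<Gamma> x = 0"
proof (induction arbitrary: x rule: sized.induct)
  case (sized_Lam_plus P \<Gamma> n t Q \<Delta> m R)
  from sized_Lam_plus.IH(1)[of "Suc x"] sized_Lam_plus.IH(2)[of x] sized_Lam_plus.prems
  show ?case by (simp add: env_apply)
qed (auto simp: env_apply)


section \<open>Lifting and substitution\<close>

text \<open>The effect of \<open>lift k\<close> on environments, as \<open>env_remove\<close> below
  is that of \<open>subst\<close> at \<open>k\<close>; the inserted variable is fresh, hence of type
  \<open>0\<close>.\<close>

definition env_insert :: "nat \<Rightarrow> env \<Rightarrow> env" where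
  "env_insert k \<Gamma> = (\<lambda>y. if y < k then \<Gamma> y else if y = k then 0 else \<Gamma> (y - 1))"

definition env_remove :: "nat \<Rightarrow> env \<Rightarrow> env" where
  "env_remove k \<Gamma> = (\<lambda>y. if y < k then \<Gamma> y else \<Gamma> (Suc y))"

lemma env_insert_zero [simp]: "env_insert k 0 = 0"
  by (auto simp: env_insert_def fun_eq_iff env_apply)

lemma env_remove_zero [simp]: "env_remove k 0 = 0"
  by (auto simp: env_remove_def fun_eq_iff env_apply)

lemma env_insert_plus: "env_insert k (\<Gamma> + \<Delta>) = env_insert k \<Gamma> + env_insert k \<Delta>"
  by (auto simp: env_insert_def fun_eq_iff env_apply)

lemma env_remove_plus: "env_remove k (\<Gamma> + \<Delta>) = env_remove k \<Gamma> + env_remove k \<Delta>"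
  by (auto simp: env_remove_def fun_eq_iff env_apply)

lemma env_insert_Suc: "env_insert (Suc k) (case_nat P \<Gamma>) = case_nat P (env_insert k \<Gamma>)"
  by (auto simp: env_insert_def fun_eq_iff split: nat.split)

lemma env_remove_Suc: "env_remove (Suc k) (case_nat P \<Gamma>) = case_nat P (env_remove k \<Gamma>)"
  by (auto simp: env_remove_def fun_eq_iff split: nat.split)

lemma env_insert_0: "env_insert 0 \<Gamma> = case_nat 0 \<Gamma>"
  by (auto simp: env_insert_def fun_eq_iff split: nat.split)

lemma env_remove_0 [simp]: "env_remove 0 (case_nat P \<Gamma>) = \<Gamma>"
  by (auto simp: env_remove_def)

lemma case_nat_eta: "case_nat (\<Gamma> 0) (env_remove 0 \<Gamma>) = \<Gamma>"
  by (auto simp: env_remove_def fun_eq_iff split: nat.split)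

lemma sized_lift: "sized \<Gamma> n t Q \<Longrightarrow> sized (env_insert k \<Gamma>) n (lift k t) Q"
proof (induction arbitrary: k rule: sized.induct)
  case (sized_Var x P)
  have "env_insert k (\<lambda>y. if y = x then P else 0) =
    (\<lambda>y. if y = (if x < k then x else Suc x) then P else 0)"
    by (auto simp: env_insert_def fun_eq_iff)
  then show ?case
    using sized.sized_Var[of "if x < k then x else Suc x" P] by (auto split: if_splits)
next
  case (sized_Lam_zero t)
  then show ?case by (simp add: sized.sized_Lam_zero)
next
  case (sized_Lam_plus P \<Gamma> n t Q \<Delta> m R)
  from sized_Lam_plus.IH(1)[of "Suc k"] sized_Lam_plus.IH(2)[of k]
  show ?case
    by (simp add: env_insert_plus env_insert_Suc sized.sized_Lam_plus)
next
  case (sized_App \<Gamma> n t P Q \<Delta> m u)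
  then show ?case by (auto simp: env_insert_plus intro: sized.sized_App)
qed

lemma case_nat_env_insert_eqD:
  "case_nat P \<Gamma> = env_insert (Suc k) \<Delta> \<Longrightarrow> \<Gamma> = env_insert k (env_remove 0 \<Delta>) \<and> \<Delta> = case_nat P (env_remove 0 \<Delta>)"
  using env_insert_Suc[of k "\<Delta> 0" "env_remove 0 \<Delta>"] by (simp add: case_nat_eta case_nat_inject)

text \<open>The index \<open>k\<close> does not occur in \<open>lift k t\<close>, so its type is
  \<open>0\<close> and the environment arises by insertion.\<close>

lemma sized_liftD: "sized \<Gamma> n (lift k t) Q \<Longrightarrow> \<exists>\<Delta>. \<Gamma> = env_insert k \<Delta> \<and> sized \<Delta> n t Q"
proof (induction t arbitrary: \<Gamma> n k Q)
  case (Var x)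
  have "\<Gamma> = (\<lambda>y. if y = (if x < k then x else Suc x) then Q else 0)" "n = 0"
    using Var by (auto elim: sized_VarE split: if_splits)
  moreover from this have "\<Gamma> = env_insert k (\<lambda>y. if y = x then Q else 0)"
    by (auto simp: env_insert_def fun_eq_iff)
  ultimately show ?case
    using sized_Var[of x Q] by blast
next
  case (Lam t)
  from Lam.prems have "sized \<Gamma> n (Lam (lift (Suc k) t)) Q" by simp
  then show ?case
  proof (induction \<Gamma> n "Lam (lift (Suc k) t)" Q rule: sized.induct)
    case sized_Lam_zero
    show ?case by (intro exI[of _ 0]) (simp add: sized.sized_Lam_zero)
  next
    case (sized_Lam_plus P \<Gamma> n Q \<Delta> m R)
    from Lam.IH[OF sized_Lam_plus.hyps(1)] obtain \<Gamma>' where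
      "\<Gamma> = env_insert k \<Gamma>'" "sized (case_nat P \<Gamma>') n t Q"
      using case_nat_env_insert_eqD by metis
    moreover obtain \<Delta>' where "\<Delta> = env_insert k \<Delta>'" "sized \<Delta>' m (Lam t) R"
      using sized_Lam_plus.hyps(4) by blast
    ultimately show ?case
      by (metis env_insert_plus sized.sized_Lam_plus)
  qed
next
  case (App t u)
  from App.prems show ?case
    by (auto elim!: sized_AppE dest!: App.IH) (metis env_insert_plus sized_App)
qed

lemma is_value_lift: "is_value v \<Longrightarrow> is_value (lift k v)"
  by (auto elim!: is_value.cases intro: is_value.intros)

text \<open>\<open>\<Gamma> k\<close> is the sum of the types of the axioms for \<open>k\<close>.
  The derivation of \<open>v\<close> is cut along this sum and each piece replaces one axiom of size
  \<open>0\<close>, so sizes simply add.\<close>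

lemma sized_subst:
  assumes "sized \<Gamma> n t Q" "is_value v" "sized \<Delta> m v (\<Gamma> k)"
  shows "sized (env_remove k \<Gamma> + \<Delta>) (n + m) (subst t v k) Q"
  using assms
proof (induction arbitrary: \<Delta> m v k rule: sized.induct)
  case (sized_Var x P)
  show ?case
  proof (cases "x = k")
    case True
    then have "env_remove k (\<lambda>y. if y = x then P else 0) = 0"
      by (auto simp: env_remove_def fun_eq_iff env_apply)
    with sized_Var True show ?thesis by simp
  next
    case False
    \<comment> \<open>An axiom for another variable asks for \<open>v\<close> at type
      \<open>0\<close>, so no piece of \<open>v\<close> is lost here.\<close>
    then have "\<Delta> = 0" "m = 0"
      using sized_value_zeroD sized_Var by auto
    moreover have "env_remove k (\<lambda>y. if y = x then P else 0) =
      (\<lambda>y. if y = (if k < x then x - 1 else x) then P else 0)"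
      using False by (auto simp: env_remove_def fun_eq_iff)
    ultimately show ?thesis
      using False sized.sized_Var[of "if k < x then x - 1 else x" P] by (auto split: if_splits)
  qed
next
  case (sized_Lam_zero t)
  then have "\<Delta> = 0" "m = 0"
    using sized_value_zeroD by (auto simp: env_apply)
  then show ?case by (simp add: sized.sized_Lam_zero)
next
  case (sized_Lam_plus P \<Gamma> n t Q \<Gamma>' n' R)
  from sized_Lam_plus.prems obtain \<Delta>1 m1 \<Delta>2 m2 where
    v: "sized \<Delta>1 m1 v (\<Gamma> k)" "sized \<Delta>2 m2 v (\<Gamma>' k)" "\<Delta> = \<Delta>1 + \<Delta>2" "m = m1 + m2"
    by (auto simp: env_apply elim: sized_value_split)
  have "sized (case_nat P (env_remove k \<Gamma> + \<Delta>1)) (n + m1) (subst t (lift 0 v) (Suc k)) Q"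
    using sized_Lam_plus.IH(1)[OF is_value_lift[OF sized_Lam_plus.prems(1), of 0], of "env_insert 0 \<Delta>1" m1 "Suc k"]
      sized_lift[OF v(1), of 0]
    by (simp add: env_remove_Suc env_insert_0 case_nat_plus)
  from sized.sized_Lam_plus[OF this] sized_Lam_plus.IH(2)[OF sized_Lam_plus.prems(1) v(2)]
  show ?case
    by (fastforce simp: v env_remove_plus ac_simps)
next
  case (sized_App \<Gamma> n t P Q \<Gamma>' n' u)
  from sized_App.prems obtain \<Delta>1 m1 \<Delta>2 m2 where
    v: "sized \<Delta>1 m1 v (\<Gamma> k)" "sized \<Delta>2 m2 v (\<Gamma>' k)" "\<Delta> = \<Delta>1 + \<Delta>2" "m = m1 + m2"
    by (auto simp: env_apply elim: sized_value_split)
  from sized.sized_App[OF sized_App.IH(1)[OF sized_App.prems(1) v(1)] sized_App.IH(2)[OF sized_App.prems(1) v(2)]]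
  show ?case
    by (simp add: v env_remove_plus ac_simps)
qed

text \<open>The pieces of \<open>v\<close> found at the occurrences of \<open>k\<close> are glued by
  \<open>sized_value_plus\<close>. Sizes are left open, since expansion only serves
  typability.\<close>

lemma sized_substD:
  assumes "is_value v" "sized \<Gamma> n (subst t v k) Q"
  shows "\<exists>\<Gamma>' n' \<Delta> m. sized \<Gamma>' n' t Q \<and> sized \<Delta> m v (\<Gamma>' k) \<and> \<Gamma> = env_remove k \<Gamma>' + \<Delta>"
  using assms
proof (induction t arbitrary: \<Gamma> n v k Q)
  case (Var x)
  show ?case
  proof (cases "x = k")
    case True
    then have "env_remove k (\<lambda>y. if y = x then Q else 0) = 0"
      by (auto simp: env_remove_def fun_eq_iff env_apply)
    with Var True show ?thesis
      by (intro exI[of _ "\<lambda>y. if y = x then Q else 0"] exI[of _ 0] exI[of _ \<Gamma>] exI[of _ n])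
        (auto intro: sized_Var)
  next
    case False
    have "\<Gamma> = (\<lambda>y. if y = (if k < x then x - 1 else x) then Q else 0)"
      using Var.prems False by (auto elim: sized_VarE split: if_splits)
    then have "\<Gamma> = env_remove k (\<lambda>y. if y = x then Q else 0)"
      using False by (auto simp: env_remove_def fun_eq_iff)
    then show ?thesis
      using False Var.prems(1)
      by (intro exI[of _ "\<lambda>y. if y = x then Q else 0"] exI[of _ "0 :: nat"] exI[of _ "0 :: env"])
        (auto intro: sized_Var sized_value_zero)
  qed
next
  case (Lam t)
  from Lam.prems(2) have "sized \<Gamma> n (Lam (subst t (lift 0 v) (Suc k))) Q" by simp
  then show ?case
  proof (induction \<Gamma> n "Lam (subst t (lift 0 v) (Suc k))" Q rule: sized.induct)
    case sized_Lam_zero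
    \<comment> \<open>The body is not typed at all, so \<open>v\<close> is used at type
      \<open>0\<close>.\<close>
    show ?case
      using sized_value_zero[OF Lam.prems(1)]
      by (intro exI[of _ "0 :: nat"] exI[of _ "0 :: env"]) (auto simp: env_apply sized.sized_Lam_zero)
  next
    case (sized_Lam_plus P \<Gamma> n Q \<Gamma>2 n2 R)
    from Lam.IH[OF is_value_lift[OF Lam.prems(1)] sized_Lam_plus.hyps(1)]
    obtain \<Gamma>' n' \<Delta> m where
      1: "sized \<Gamma>' n' t Q" "sized \<Delta> m (lift 0 v) (\<Gamma>' (Suc k))"
        "case_nat P \<Gamma> = env_remove (Suc k) \<Gamma>' + \<Delta>"
      by blast
    from sized_liftD[OF 1(2)] obtain \<Delta>' where
      2: "\<Delta> = case_nat 0 \<Delta>'" "sized \<Delta>' m v (\<Gamma>' (Suc k))"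
      by (auto simp: env_insert_0)
    \<comment> \<open>\<open>\<Gamma>'\<close> assigns types to the body; it is separated into the
      bound variable, index 0, and the outer variables, among which \<open>k\<close> was
      \<open>Suc k\<close>.\<close>
    define \<Gamma>'' where "\<Gamma>'' = env_remove 0 \<Gamma>'"
    have 3: "\<Gamma>' = case_nat (\<Gamma>' 0) \<Gamma>''"
      by (simp add: \<Gamma>''_def case_nat_eta)
    have "case_nat P \<Gamma> = case_nat (\<Gamma>' 0) (env_remove k \<Gamma>'' + \<Delta>')"
      using 1(3) unfolding 2(1) by (subst (asm) 3) (simp add: env_remove_Suc case_nat_plus)
    then have 4: "P = \<Gamma>' 0" "\<Gamma> = env_remove k \<Gamma>'' + \<Delta>'"
      by (simp_all add: case_nat_inject)
    have 5: "\<Gamma>' (Suc k) = \<Gamma>'' k"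
      by (simp add: \<Gamma>''_def env_remove_def)
    obtain \<Gamma>3 n3 \<Delta>3 m3 where
      6: "sized \<Gamma>3 n3 (Lam t) R" "sized \<Delta>3 m3 v (\<Gamma>3 k)" "\<Gamma>2 = env_remove k \<Gamma>3 + \<Delta>3"
      using sized_Lam_plus.hyps(4) by blast
    have "sized (\<Gamma>'' + \<Gamma>3) (n' + n3) (Lam t) (PT {#(P, Q)#} + R)"
      using 1(1) 3 4(1) 6(1) by (intro sized.sized_Lam_plus) auto
    moreover have "sized (\<Delta>' + \<Delta>3) (m + m3) v ((\<Gamma>'' + \<Gamma>3) k)"
      using sized_value_plus[OF Lam.prems(1) 2(2) 6(2)] by (simp add: 5 env_apply)
    moreover have "\<Gamma> + \<Gamma>2 = env_remove k (\<Gamma>'' + \<Gamma>3) + (\<Delta>' + \<Delta>3)"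
      by (simp add: 4 6 env_remove_plus ac_simps)
    ultimately show ?case by blast
  qed
next
  case (App t u)
  from App.prems(2) obtain \<Gamma>1 n1 P \<Gamma>2 n2 where
    *: "\<Gamma> = \<Gamma>1 + \<Gamma>2" "sized \<Gamma>1 n1 (subst t v k) (PT {#(P, Q)#})" "sized \<Gamma>2 n2 (subst u v k) P"
    by (auto elim: sized_AppE)
  obtain \<Gamma>1' n1' \<Delta>1 m1 where
    1: "sized \<Gamma>1' n1' t (PT {#(P, Q)#})" "sized \<Delta>1 m1 v (\<Gamma>1' k)" "\<Gamma>1 = env_remove k \<Gamma>1' + \<Delta>1"
    using App.IH(1)[OF App.prems(1) *(2)] by blast
  obtain \<Gamma>2' n2' \<Delta>2 m2 where
    2: "sized \<Gamma>2' n2' u P" "sized \<Delta>2 m2 v (\<Gamma>2' k)" "\<Gamma>2 = env_remove k \<Gamma>2' + \<Delta>2"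
    using App.IH(2)[OF App.prems(1) *(3)] by blast
  have "sized (\<Delta>1 + \<Delta>2) (m1 + m2) v ((\<Gamma>1' + \<Gamma>2') k)"
    using sized_value_plus[OF App.prems(1) 1(2) 2(2)] by (simp add: env_apply)
  moreover have "\<Gamma> = env_remove k (\<Gamma>1' + \<Gamma>2') + (\<Delta>1 + \<Delta>2)"
    by (simp add: *(1) 1 2 env_remove_plus ac_simps)
  ultimately show ?case
    using sized_App[OF 1(1) 2(1)] by blast
qed


section \<open>Subject reduction and expansion\<close>

lemma sized_App_iff:
  "sized \<Gamma> n (App t u) Q \<longleftrightarrow> (\<exists>\<Gamma>1 n1 P \<Gamma>2 n2. \<Gamma> = \<Gamma>1 + \<Gamma>2 \<and> n = Suc (n1 + n2) \<and>
    sized \<Gamma>1 n1 t (PT {#(P, Q)#}) \<and> sized \<Gamma>2 n2 u P)"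
  by (rule iffI, erule sized_AppE) (blast intro: sized_App)+

lemma sized_beta_v:
  assumes "beta_v s s'" "sized \<Gamma> n s Q"
  shows "\<exists>n'. n = Suc n' \<and> sized \<Gamma> n' s' Q"
  using assms
proof cases
  case (1 v t)
  from assms(2) obtain \<Gamma>1 n1 P \<Gamma>2 n2 where
    *: "\<Gamma> = \<Gamma>1 + \<Gamma>2" "n = Suc (n1 + n2)" "sized (case_nat P \<Gamma>1) n1 t Q" "sized \<Gamma>2 n2 v P"
    by (auto simp: 1 sized_App_iff sized_Lam_single_iff)
  from sized_subst[OF *(3) 1(3), of \<Gamma>2 n2 0] *(4)
  show ?thesis by (simp add: * 1)
qed

lemma sized_beta_v_expansion:
  assumes "beta_v s s'" "sized \<Gamma> n s' Q"
  shows "\<exists>n. sized \<Gamma> n s Q"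
  using assms(1)
proof cases
  case (1 v t)
  from sized_substD[OF 1(3) assms(2)[unfolded 1(2)]] obtain \<Gamma>' n' \<Delta> m where
    *: "sized \<Gamma>' n' t Q" "sized \<Delta> m v (\<Gamma>' 0)" "\<Gamma> = env_remove 0 \<Gamma>' + \<Delta>"
    by blast
  \<comment> \<open>The argument type of the rebuilt redex is the type at which the body demands
    \<open>v\<close>.\<close>
  have "sized (env_remove 0 \<Gamma>') n' (Lam t) (PT {#(\<Gamma>' 0, Q)#})"
    using *(1) by (simp add: sized_Lam_single_iff case_nat_eta)
  from sized_App[OF this *(2)] show ?thesis
    by (auto simp: * 1)
qed

text \<open>The second summand is the environment of a lifted term and gives index 0 nothing, so all
  of \<open>P\<close> stems from \<open>\<Gamma>1\<close>.\<close>

lemma case_nat_eq_plus_case_nat_zeroD: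
  fixes \<Gamma> \<Gamma>1 \<Delta> :: env
  assumes "case_nat P \<Gamma> = \<Gamma>1 + case_nat 0 \<Delta>"
  shows "\<Gamma>1 = case_nat P (env_remove 0 \<Gamma>1)" "\<Gamma> = env_remove 0 \<Gamma>1 + \<Delta>"
proof -
  have "case_nat P \<Gamma> = case_nat (\<Gamma>1 0) (env_remove 0 \<Gamma>1 + \<Delta>)"
    using assms by (subst (asm) case_nat_eta[of \<Gamma>1, symmetric]) (simp add: case_nat_plus)
  then have "P = \<Gamma>1 0" "\<Gamma> = env_remove 0 \<Gamma>1 + \<Delta>"
    by (simp_all add: case_nat_inject)
  then show "\<Gamma>1 = case_nat P (env_remove 0 \<Gamma>1)" "\<Gamma> = env_remove 0 \<Gamma>1 + \<Delta>"
    by (simp_all add: case_nat_eta)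
qed

text \<open>The side condition of \<open>sigma1\<close> in terms of types: \<open>s\<close> takes no
  share of the bound variable, so its environment can cross the binder in both directions.\<close>

lemma sized_App_lift_right_iff:
  "sized (case_nat R \<Gamma>) n (App t (lift 0 s)) Q \<longleftrightarrow>
    (\<exists>\<Gamma>1 n1 P \<Gamma>2 n2. \<Gamma> = \<Gamma>1 + \<Gamma>2 \<and> n = Suc (n1 + n2) \<and>
      sized (case_nat R \<Gamma>1) n1 t (PT {#(P, Q)#}) \<and> sized \<Gamma>2 n2 s P)" (is "?L \<longleftrightarrow> ?R")
proof
  assume ?L
  then obtain \<Gamma>1 n1 P \<Gamma>2 n2 where *: "case_nat R \<Gamma> = \<Gamma>1 + \<Gamma>2" "n = Suc (n1 + n2)"
    "sized \<Gamma>1 n1 t (PT {#(P, Q)#})" "sized \<Gamma>2 n2 (lift 0 s) P"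
    by (auto simp: sized_App_iff)
  obtain \<Delta> where \<Delta>: "\<Gamma>2 = case_nat 0 \<Delta>" "sized \<Delta> n2 s P"
    using sized_liftD[OF *(4)] by (auto simp: env_insert_0)
  note eq = case_nat_eq_plus_case_nat_zeroD[OF *(1)[unfolded \<Delta>(1)]]
  have "sized (case_nat R (env_remove 0 \<Gamma>1)) n1 t (PT {#(P, Q)#})"
    using *(3) eq(1) by metis
  with eq(2) *(2) \<Delta>(2) show ?R by blast
next
  assume ?R
  then obtain \<Gamma>1 n1 P \<Gamma>2 n2 where *: "\<Gamma> = \<Gamma>1 + \<Gamma>2" "n = Suc (n1 + n2)"
    "sized (case_nat R \<Gamma>1) n1 t (PT {#(P, Q)#})" "sized \<Gamma>2 n2 s P"
    by blast
  from sized_App[OF *(3) sized_lift[OF *(4), of 0]] show ?L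
    by (simp add: * env_insert_0 case_nat_plus)
qed

lemma sized_App_lift_left_iff:
  "sized (case_nat R \<Gamma>) n (App (lift 0 s) t) Q \<longleftrightarrow>
    (\<exists>\<Gamma>1 n1 P \<Gamma>2 n2. \<Gamma> = \<Gamma>1 + \<Gamma>2 \<and> n = Suc (n1 + n2) \<and>
      sized \<Gamma>1 n1 s (PT {#(P, Q)#}) \<and> sized (case_nat R \<Gamma>2) n2 t P)" (is "?L \<longleftrightarrow> ?R")
proof
  assume ?L
  then obtain \<Gamma>1 n1 P \<Gamma>2 n2 where *: "case_nat R \<Gamma> = \<Gamma>2 + \<Gamma>1" "n = Suc (n1 + n2)"
    "sized \<Gamma>1 n1 (lift 0 s) (PT {#(P, Q)#})" "sized \<Gamma>2 n2 t P"
    by (auto simp: sized_App_iff add.commute)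
  obtain \<Delta> where \<Delta>: "\<Gamma>1 = case_nat 0 \<Delta>" "sized \<Delta> n1 s (PT {#(P, Q)#})"
    using sized_liftD[OF *(3)] by (auto simp: env_insert_0)
  note eq = case_nat_eq_plus_case_nat_zeroD[OF *(1)[unfolded \<Delta>(1)]]
  have "sized (case_nat R (env_remove 0 \<Gamma>2)) n2 t P"
    using *(4) eq(1) by metis
  moreover have "\<Gamma> = \<Delta> + env_remove 0 \<Gamma>2"
    using eq(2) by (simp add: add.commute)
  ultimately show ?R using *(2) \<Delta>(2) by blast
next
  assume ?R
  then obtain \<Gamma>1 n1 P \<Gamma>2 n2 where *: "\<Gamma> = \<Gamma>1 + \<Gamma>2" "n = Suc (n1 + n2)"
    "sized \<Gamma>1 n1 s (PT {#(P, Q)#})" "sized (case_nat R \<Gamma>2) n2 t P"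
    by blast
  from sized_App[OF sized_lift[OF *(3), of 0] *(4)] show ?L
    by (simp add: * env_insert_0 case_nat_plus)
qed

lemma sized_App_Lam_iff:
  "sized \<Gamma> n (App (Lam t) u) Q \<longleftrightarrow> (\<exists>\<Gamma>1 n1 P \<Gamma>2 n2. \<Gamma> = \<Gamma>1 + \<Gamma>2 \<and> n = Suc (n1 + n2) \<and>
    sized (case_nat P \<Gamma>1) n1 t Q \<and> sized \<Gamma>2 n2 u P)"
  unfolding sized_App_iff sized_Lam_single_iff ..

text \<open>Both sides consist of the same derivations of \<open>t\<close>, \<open>u\<close> and
  \<open>w\<close> joined by two applications; only the order of assembly differs.\<close>

lemma sized_sigma1_iff:
  assumes "sigma1 s s'"
  shows "sized \<Gamma> n s Q \<longleftrightarrow> sized \<Gamma> n s' Q"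
  using assms
proof cases
  case (1 t u w)
  show ?thesis
    unfolding 1
  proof
    assume "sized \<Gamma> n (App (App (Lam t) u) w) Q"
    then obtain \<Gamma>' n' \<Gamma>3 n3 P where
      1: "\<Gamma> = \<Gamma>' + \<Gamma>3" "n = Suc (n' + n3)" "sized \<Gamma>' n' (App (Lam t) u) (PT {#(P, Q)#})"
      and w: "sized \<Gamma>3 n3 w P"
      unfolding sized_App_iff[of _ _ _ w] by blast
    from 1(3) obtain \<Gamma>1 n1 \<Gamma>2 n2 R where
      2: "\<Gamma>' = \<Gamma>1 + \<Gamma>2" "n' = Suc (n1 + n2)"
      and t: "sized (case_nat R \<Gamma>1) n1 t (PT {#(P, Q)#})" and u: "sized \<Gamma>2 n2 u R"
      unfolding sized_App_Lam_iff by blast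
    from t w have "sized (case_nat R (\<Gamma>1 + \<Gamma>3)) (Suc (n1 + n3)) (App t (lift 0 w)) Q"
      unfolding sized_App_lift_right_iff by blast
    with u have "sized (\<Gamma>1 + \<Gamma>3 + \<Gamma>2) (Suc (Suc (n1 + n3) + n2)) (App (Lam (App t (lift 0 w))) u) Q"
      unfolding sized_App_Lam_iff by blast
    then show "sized \<Gamma> n (App (Lam (App t (lift 0 w))) u) Q"
      by (simp add: 1 2 ac_simps)
  next
    assume "sized \<Gamma> n (App (Lam (App t (lift 0 w))) u) Q"
    then obtain \<Gamma>' n' \<Gamma>2 n2 R where
      1: "\<Gamma> = \<Gamma>' + \<Gamma>2" "n = Suc (n' + n2)" "sized (case_nat R \<Gamma>') n' (App t (lift 0 w)) Q"
      and u: "sized \<Gamma>2 n2 u R"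
      unfolding sized_App_Lam_iff by blast
    from 1(3) obtain \<Gamma>1 n1 \<Gamma>3 n3 P where
      2: "\<Gamma>' = \<Gamma>1 + \<Gamma>3" "n' = Suc (n1 + n3)"
      and t: "sized (case_nat R \<Gamma>1) n1 t (PT {#(P, Q)#})" and w: "sized \<Gamma>3 n3 w P"
      unfolding sized_App_lift_right_iff by blast
    from t u have "sized (\<Gamma>1 + \<Gamma>2) (Suc (n1 + n2)) (App (Lam t) u) (PT {#(P, Q)#})"
      unfolding sized_App_Lam_iff by blast
    from sized_App[OF this w] show "sized \<Gamma> n (App (App (Lam t) u) w) Q"
      by (simp add: 1 2 ac_simps)
  qed
qed

lemma sized_sigma3_iff:
  assumes "sigma3 s s'"
  shows "sized \<Gamma> n s Q \<longleftrightarrow> sized \<Gamma> n s' Q"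
  using assms
proof cases
  case (1 v w u)
  show ?thesis
    unfolding 1
  proof
    assume "sized \<Gamma> n (App v (App (Lam w) u)) Q"
    then obtain \<Gamma>' n' \<Gamma>1 n1 P where
      1: "\<Gamma> = \<Gamma>1 + \<Gamma>'" "n = Suc (n1 + n')" "sized \<Gamma>' n' (App (Lam w) u) P"
      and v: "sized \<Gamma>1 n1 v (PT {#(P, Q)#})"
      unfolding sized_App_iff[of _ _ v] by blast
    from 1(3) obtain \<Gamma>2 n2 \<Gamma>3 n3 R where
      2: "\<Gamma>' = \<Gamma>2 + \<Gamma>3" "n' = Suc (n2 + n3)"
      and w: "sized (case_nat R \<Gamma>2) n2 w P" and u: "sized \<Gamma>3 n3 u R"
      unfolding sized_App_Lam_iff by blast
    from v w have "sized (case_nat R (\<Gamma>1 + \<Gamma>2)) (Suc (n1 + n2)) (App (lift 0 v) w) Q"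
      unfolding sized_App_lift_left_iff by blast
    with u have "sized (\<Gamma>1 + \<Gamma>2 + \<Gamma>3) (Suc (Suc (n1 + n2) + n3)) (App (Lam (App (lift 0 v) w)) u) Q"
      unfolding sized_App_Lam_iff by blast
    then show "sized \<Gamma> n (App (Lam (App (lift 0 v) w)) u) Q"
      by (simp add: 1 2 ac_simps)
  next
    assume "sized \<Gamma> n (App (Lam (App (lift 0 v) w)) u) Q"
    then obtain \<Gamma>' n' \<Gamma>3 n3 R where
      1: "\<Gamma> = \<Gamma>' + \<Gamma>3" "n = Suc (n' + n3)" "sized (case_nat R \<Gamma>') n' (App (lift 0 v) w) Q"
      and u: "sized \<Gamma>3 n3 u R"
      unfolding sized_App_Lam_iff by blast
    from 1(3) obtain \<Gamma>1 n1 \<Gamma>2 n2 P where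
      2: "\<Gamma>' = \<Gamma>1 + \<Gamma>2" "n' = Suc (n1 + n2)"
      and v: "sized \<Gamma>1 n1 v (PT {#(P, Q)#})" and w: "sized (case_nat R \<Gamma>2) n2 w P"
      unfolding sized_App_lift_left_iff by blast
    from w u have "sized (\<Gamma>2 + \<Gamma>3) (Suc (n2 + n3)) (App (Lam w) u) P"
      unfolding sized_App_Lam_iff by blast
    from sized_App[OF v this] show "sized \<Gamma> n (App v (App (Lam w) u)) Q"
      by (simp add: 1 2 ac_simps)
  qed
qed

section \<open>Closing root steps under contexts\<close>

lemma typing_Lam_mono:
  assumes "\<And>\<Gamma> Q. \<Gamma> \<turnstile> t : Q \<Longrightarrow> \<Gamma> \<turnstile> t' : Q" and "\<Gamma> \<turnstile> Lam t : Q"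
  shows "\<Gamma> \<turnstile> Lam t' : Q"
  using assms(2)
proof cases
  case (lam n P \<Gamma>' Q')
  show ?thesis
    unfolding lam(1,2) using lam(3) by (intro typing.lam assms(1))
qed

lemma typing_App_mono:
  assumes "\<And>\<Gamma> Q. \<Gamma> \<turnstile> t : Q \<Longrightarrow> \<Gamma> \<turnstile> t' : Q" "\<And>\<Gamma> Q. \<Gamma> \<turnstile> u : Q \<Longrightarrow> \<Gamma> \<turnstile> u' : Q"
    and "\<Gamma> \<turnstile> App t u : Q"
  shows "\<Gamma> \<turnstile> App t' u' : Q"
  using assms(3) by cases (auto intro!: typing.app assms(1,2))

text \<open>Under an arbitrary abstraction the hole may be typed any number of times, even zero, so
  sizes are not controlled and only typability is transported.\<close>

lemma typing_plug_mono:
  assumes "\<And>\<Gamma> Q. \<Gamma> \<turnstile> s : Q \<Longrightarrow> \<Gamma> \<turnstile> s' : Q"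
  shows "\<Gamma> \<turnstile> plug C s : Q \<Longrightarrow> \<Gamma> \<turnstile> plug C s' : Q"
proof (induction C arbitrary: \<Gamma> Q)
  case Hole
  then show ?case by (simp add: assms)
next
  case (CLam C)
  from typing_Lam_mono[OF CLam.IH] CLam.prems show ?case by simp
next
  case (CAppL C t)
  from typing_App_mono[OF CAppL.IH, of _ t t] CAppL.prems show ?case by simp
next
  case (CAppR t C)
  from typing_App_mono[OF _ CAppR.IH, of t t] CAppR.prems show ?case by simp
qed

lemma typing_red_iff:
  assumes "\<And>s s' \<Gamma> Q. r s s' \<Longrightarrow> \<Gamma> \<turnstile> s : Q \<longleftrightarrow> \<Gamma> \<turnstile> s' : Q" and "red r t u"
  shows "\<Gamma> \<turnstile> t : Q \<longleftrightarrow> \<Gamma> \<turnstile> u : Q"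
  using assms(2) by cases (auto simp: assms(1) elim!: typing_plug_mono[rotated])

lemma typing_shuf_iff: "shuf t u \<Longrightarrow> \<Gamma> \<turnstile> t : Q \<longleftrightarrow> \<Gamma> \<turnstile> u : Q"
  unfolding shuf_def
proof (elim disjE)
  show "red beta_v t u \<Longrightarrow> ?thesis"
    by (rule typing_red_iff) (auto simp: typing_iff_sized dest: sized_beta_v sized_beta_v_expansion)
  show "red sigma1 t u \<Longrightarrow> ?thesis"
    by (rule typing_red_iff) (auto simp: typing_iff_sized sized_sigma1_iff)
  show "red sigma3 t u \<Longrightarrow> ?thesis"
    by (rule typing_red_iff) (auto simp: typing_iff_sized sized_sigma3_iff)
qed

lemma typing_shuf_equiv_iff: "t \<simeq>\<^sub>s\<^sub>h\<^sub>u\<^sub>f u \<Longrightarrow> \<Gamma> \<turnstile> t : Q \<longleftrightarrow> \<Gamma> \<turnstile> u : Q"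
  by (induction rule: equivclp_induct) (auto simp: typing_shuf_iff)

text \<open>\<open>d\<close> is the exact loss at the root: 1 for \<open>beta_v\<close>, 0 for the
  \<open>\<sigma>\<close>-rules. It is passed on unchanged because a balanced context has its hole
  typed exactly once.\<close>

lemma sized_plug_balanced:
  assumes "balanced B" and "\<And>\<Gamma> n Q. sized \<Gamma> n s Q \<Longrightarrow> \<exists>n'. n = n' + d \<and> sized \<Gamma> n' s' Q"
    and "sized \<Gamma> n (plug B s) Q"
  shows "\<exists>n'. n = n' + d \<and> sized \<Gamma> n' (plug B s') Q"
proof -
  \<comment> \<open>The assumption is restricted to singleton types so that it also covers an
    applied abstraction, where the claim is available only at such types.\<close>
  have left: "\<exists>n'. n = n' + d \<and> sized \<Gamma> n' (App t' u) Q"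
    if step: "\<And>\<Gamma> n P. sized \<Gamma> n t (PT {#P#}) \<Longrightarrow> \<exists>n'. n = n' + d \<and> sized \<Gamma> n' t' (PT {#P#})"
      and "sized \<Gamma> n (App t u) Q" for \<Gamma> n Q t t' u
  proof -
    from that(2) obtain \<Gamma>1 n1 P \<Gamma>2 n2 where 1: "\<Gamma> = \<Gamma>1 + \<Gamma>2" "n = Suc (n1 + n2)"
      "sized \<Gamma>1 n1 t (PT {#(P, Q)#})" "sized \<Gamma>2 n2 u P"
      unfolding sized_App_iff by blast
    obtain n1' where n1': "n1 = n1' + d" "sized \<Gamma>1 n1' t' (PT {#(P, Q)#})"
      using step[OF 1(3)] by blast
    from sized_App[OF n1'(2) 1(4)] show ?thesis
      by (intro exI[of _ "Suc (n1' + n2)"]) (simp add: 1 n1')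
  qed
  from assms(1,3) show ?thesis
  proof (induction arbitrary: \<Gamma> n Q rule: balanced.induct)
    case 1
    then show ?case using assms(2) by simp
  next
    case (2 B t)
    have "\<exists>n'. n = n' + d \<and> sized \<Gamma> n' (Lam (plug B s')) (PT {#P#})"
      if "sized \<Gamma> n (Lam (plug B s)) (PT {#P#})" for \<Gamma> n P
      using that 2(2) by (cases P) (auto simp: sized_Lam_single_iff)
    from left[OF this] 2(3) show ?case by simp
  next
    case (3 B t)
    from left[OF 3(2)] 3(3) show ?case by simp
  next
    case (4 B t)
    from 4(3) have "sized \<Gamma> n (App t (plug B s)) Q" by simp
    then obtain \<Gamma>1 n1 P \<Gamma>2 n2 where 1: "\<Gamma> = \<Gamma>1 + \<Gamma>2" "n = Suc (n1 + n2)"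
      "sized \<Gamma>1 n1 t (PT {#(P, Q)#})" "sized \<Gamma>2 n2 (plug B s) P"
      unfolding sized_App_iff by blast
    obtain n2' where n2': "n2 = n2' + d" "sized \<Gamma>2 n2' (plug B s') P"
      using 4(2)[OF 1(4)] by blast
    from sized_App[OF 1(3) n2'(2)] show ?case
      by (intro exI[of _ "Suc (n1 + n2')"]) (simp add: 1 n2')
  qed
qed


section \<open>Strong normalization of typable terms\<close>

primrec tsize :: "trm \<Rightarrow> nat" where
  "tsize (Var x) = 1"
| "tsize (Lam t) = Suc (tsize t)"
| "tsize (App t u) = Suc (tsize t + tsize u)"

text \<open>Counted by nodes, this is the sum over all nodes of the number of abstractions strictly
  above them.\<close>

primrec body_sizes :: "trm \<Rightarrow> nat" where
  "body_sizes (Var x) = 0"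
| "body_sizes (Lam t) = tsize t + body_sizes t"
| "body_sizes (App t u) = body_sizes t + body_sizes u"

text \<open>Each of the \<open>tsize t\<close> nodes lies under fewer than \<open>tsize t\<close>
  abstractions. The bound turns growth of \<open>body_sizes\<close> at constant size into
  descent.\<close>

lemma body_sizes_le: "body_sizes t \<le> tsize t * tsize t"
  by (induction t) (auto simp: algebra_simps)

lemma tsize_lift [simp]: "tsize (lift k t) = tsize t"
  by (induction t arbitrary: k) auto

lemma body_sizes_lift [simp]: "body_sizes (lift k t) = body_sizes t"
  by (induction t arbitrary: k) auto

text \<open>Equality of sizes carries the strict inequality through \<open>CLam\<close>, which adds
  the size of the body on each side.\<close>

lemma plug_body_sizes:
  assumes "tsize s = tsize s'" "body_sizes s < body_sizes s'"
  shows "tsize (plug C s) = tsize (plug C s') \<and> body_sizes (plug C s) < body_sizes (plug C s')"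
  by (induction C) (auto simp: assms)

text \<open>The \<open>\<sigma>\<close>-rules keep the size of the term and move a subterm into the body of an abstraction.\<close>

definition shuffle_potential :: "trm \<Rightarrow> nat" where
  "shuffle_potential t = tsize t * tsize t - body_sizes t"

lemma shuffle_potential_less:
  assumes "tsize t = tsize u" "body_sizes t < body_sizes u"
  shows "shuffle_potential u < shuffle_potential t"
  using assms body_sizes_le[of u] by (simp add: shuffle_potential_def)

lemma bal_red_sigma_shuffle_potential:
  assumes "bal_red sigma1 t u \<or> bal_red sigma3 t u"
  shows "shuffle_potential u < shuffle_potential t"
proof -
  \<comment> \<open>The body of the abstraction gains one application and the moved term; lifting
    changes neither measure.\<close>
  have "tsize s = tsize s' \<and> body_sizes s < body_sizes s'" if "sigma1 s s' \<or> sigma3 s s'" for s s'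
    using that by (auto elim!: sigma1.cases sigma3.cases)
  with assms show ?thesis
    by (auto elim!: bal_red.cases intro!: shuffle_potential_less dest: plug_body_sizes)
qed

text \<open>The order is lexicographic with the derivation size first, since a
  \<open>beta_v\<close>-step may duplicate a value and raise the potential.\<close>

lemma sized_bal_shuf:
  assumes "bal_shuf t u" "sized \<Gamma> n t Q"
  shows "\<exists>n'. sized \<Gamma> n' u Q \<and> (n' < n \<or> n' = n \<and> shuffle_potential u < shuffle_potential t)"
proof -
  consider "bal_red beta_v t u" | "bal_red sigma1 t u \<or> bal_red sigma3 t u"
    using assms(1) by (auto simp: bal_shuf_def)
  then show ?thesis
  proof cases
    case 1
    then obtain B s s' where "balanced B" "beta_v s s'" "t = plug B s" "u = plug B s'"
      by (auto elim: bal_red.cases)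
    then show ?thesis
      using sized_plug_balanced[of B s 1 s' \<Gamma> n Q] assms(2) sized_beta_v[of s s'] by fastforce
  next
    case 2
    then obtain B s s' where "balanced B" "sigma1 s s' \<or> sigma3 s s'" "t = plug B s" "u = plug B s'"
      by (auto elim!: bal_red.cases)
    then have "sized \<Gamma> n u Q"
      using sized_plug_balanced[of B s 0 s' \<Gamma> n Q] assms(2) sized_sigma1_iff sized_sigma3_iff by fastforce
    then show ?thesis
      using bal_red_sigma_shuffle_potential[OF 2] by blast
  qed
qed

lemma typing_strongly_normalizable:
  assumes "\<Gamma> \<turnstile> t : Q"
  shows "strongly_normalizable bal_shuf t"
proof -
  obtain n where n: "sized \<Gamma> n t Q"
    using assms typing_iff_sized by blast
  have "f 0 = t \<Longrightarrow> \<not> (\<forall>i. bal_shuf (f i) (f (Suc i)))" for f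
    using n
  proof (induction "(n, shuffle_potential t)" arbitrary: n t f rule: wf_induct_rule[OF wf_lex_prod[OF wf_less_than wf_less_than]])
    case (1 n t f)
    show ?case
    proof
      assume f: "\<forall>i. bal_shuf (f i) (f (Suc i))"
      then have "bal_shuf t (f 1)" using 1(2) by auto
      from sized_bal_shuf[OF this 1(3)] obtain n' where
        n': "sized \<Gamma> n' (f 1) Q" "((n', shuffle_potential (f 1)), (n, shuffle_potential t)) \<in> less_than <*lex*> less_than"
        by auto
      from 1(1)[OF n'(2), of "\<lambda>i. f (Suc i)"] n'(1) f show False by simp
    qed
  qed
  then show ?thesis
    by (auto simp: strongly_normalizable_def)
qed

text \<open>If no reduct is normal, dependent choice picks successors forever; the clause for
  \<open>i = 0\<close> pins the start to \<open>t\<close>.\<close>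

lemma strongly_normalizable_imp_normalizable:
  assumes "strongly_normalizable R t"
  shows "normalizable R t"
proof (rule ccontr)
  assume not: "\<not> normalizable R t"
  have "\<exists>f. \<forall>i. R\<^sup>*\<^sup>* t (f i) \<and> (i = 0 \<longrightarrow> f i = t) \<and> R (f i) (f (Suc i))"
  proof (rule dependent_nat_choice[where P = "\<lambda>i u. R\<^sup>*\<^sup>* t u \<and> (i = 0 \<longrightarrow> u = t)" and Q = "\<lambda>_. R", simplified conj_assoc])
    show "\<exists>u. R\<^sup>*\<^sup>* t u \<and> (0 = (0::nat) \<longrightarrow> u = t)" by auto
    fix u and i :: nat
    assume "R\<^sup>*\<^sup>* t u \<and> (i = 0 \<longrightarrow> u = t)"
    moreover from this obtain w where "R u w"
      using not by (auto simp: normalizable_def normal_def)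
    ultimately show "\<exists>w. R\<^sup>*\<^sup>* t w \<and> (Suc i = 0 \<longrightarrow> w = t) \<and> R u w"
      by (auto intro: rtranclp.rtrancl_into_rtrancl)
  qed
  with assms show False
    by (auto simp: strongly_normalizable_def)
qed


section \<open>Typability of normal terms\<close>

lemma normal_bal_shuf_plug: "balanced B \<Longrightarrow> normal bal_shuf (plug B t) \<Longrightarrow> normal bal_shuf t"
proof -
  \<comment> \<open>Balanced contexts compose, so a step inside \<open>t\<close> is a step of
    \<open>plug B t\<close>.\<close>
  have comp: "\<exists>B'. balanced B' \<and> (\<forall>s. plug B' s = plug B (plug D s))"
    if "balanced B" "balanced D" for B D
    using that
  proof (induction rule: balanced.induct)
    case 1
    then show ?case by auto
  next
    case (2 B t)
    then obtain B' where "balanced B'" "\<forall>s. plug B' s = plug B (plug D s)" by blast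
    then show ?case by (intro exI[of _ "CAppL (CLam B') t"]) (auto intro: balanced.intros)
  next
    case (3 B t)
    then obtain B' where "balanced B'" "\<forall>s. plug B' s = plug B (plug D s)" by blast
    then show ?case by (intro exI[of _ "CAppL B' t"]) (auto intro: balanced.intros)
  next
    case (4 B t)
    then obtain B' where "balanced B'" "\<forall>s. plug B' s = plug B (plug D s)" by blast
    then show ?case by (intro exI[of _ "CAppR t B'"]) (auto intro: balanced.intros)
  qed
  have "bal_red r (plug B t) (plug B u)" if "balanced B" "bal_red r t u" for r t u B
    using that(2)
  proof cases
    case (1 D s s')
    with comp[OF that(1) 1(3)] show ?thesis
      by (metis bal_red.intros)
  qed
  then show "balanced B \<Longrightarrow> normal bal_shuf (plug B t) \<Longrightarrow> normal bal_shuf t"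
    by (fastforce simp: normal_def bal_shuf_def)
qed

lemma normal_bal_shuf_root:
  assumes "normal bal_shuf t"
  shows "\<not> beta_v t u" "\<not> sigma1 t u" "\<not> sigma3 t u"
  using assms bal_red.intros[OF balanced.intros(1), of _ t u]
  by (auto simp: normal_def bal_shuf_def)

text \<open>A normal term that is neither a value nor of the form \<open>(\<lambda>x. s) u\<close> has a variable in head
  position that is free in it; choosing the type of that variable gives the term any type.\<close>

lemma normal_typable:
  "normal bal_shuf t \<Longrightarrow> (\<exists>\<Gamma> Q. \<Gamma> \<turnstile> t : Q) \<and>
    (\<not> is_value t \<and> (\<nexists>s u. t = App (Lam s) u) \<longrightarrow> (\<forall>Q. \<exists>\<Gamma>. \<Gamma> \<turnstile> t : Q))"
proof (induction t rule: measure_induct_rule[of size])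
  case (less t)
  \<comment> \<open>The body of an unapplied abstraction may be untypable; type \<open>0\<close>
    avoids typing it.\<close>
  have value_zero: "\<exists>\<Gamma>. \<Gamma> \<turnstile> v : 0" if "is_value v" for v
    using sized_value_zero[OF that] sized_imp_typing by blast
  show ?case
  proof (cases t)
    case (Var x)
    then show ?thesis using value_zero[of t] by (auto intro: is_value.intros)
  next
    case (Lam t')
    then show ?thesis using value_zero[of t] by (auto intro: is_value.intros)
  next
    case (App s u)
    have s: "normal bal_shuf s" and u: "normal bal_shuf u"
      using less.prems normal_bal_shuf_plug[of "CAppL Hole u" s] normal_bal_shuf_plug[of "CAppR s Hole" u]
      by (auto simp: App intro: balanced.intros)
    note IHs = less.IH[OF _ s] and IHu = less.IH[OF _ u]
    \<comment> \<open>A value applied to \<open>App (Lam s') u'\<close> would be a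
      \<open>sigma3\<close>-redex, so \<open>u\<close> falls under the stronger half of the
      induction hypothesis.\<close>
    have u_any: "\<forall>Q. \<exists>\<Gamma>. \<Gamma> \<turnstile> u : Q" if "is_value s" "\<not> is_value u"
    proof -
      have "\<nexists>s' u'. u = App (Lam s') u'"
        using normal_bal_shuf_root(3)[OF less.prems] that(1) by (auto simp: App intro: sigma3.intros)
      then show ?thesis using IHu that(2) by (simp add: App)
    qed
    show ?thesis
    proof (cases s)
      case (Var x)
      obtain P \<Gamma> where "\<Gamma> \<turnstile> u : P"
        using IHu by (auto simp: App)
      from typing.app[OF typing.ax this]
      have "\<exists>\<Gamma>. \<Gamma> \<turnstile> t : Q" for Q
        unfolding App Var by blast
      then show ?thesis by blast
    next
      \<comment> \<open>The body is normal, because an applied abstraction is a balanced context. It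
        fixes the type \<open>\<Gamma> 0\<close> demanded of \<open>u\<close>, and \<open>u\<close>,
        not being a value by \<open>beta_v\<close>-normality, accepts every type.\<close>
      case (Lam s')
      have "normal bal_shuf s'"
        using less.prems normal_bal_shuf_plug[of "CAppL (CLam Hole) u" s']
        by (auto simp: App Lam intro: balanced.intros)
      then obtain \<Gamma> Q n where "sized \<Gamma> n s' Q"
        using less.IH[of s'] by (auto simp: App Lam typing_iff_sized)
      then have "env_remove 0 \<Gamma> \<turnstile> Lam s' : PT {#(\<Gamma> 0, Q)#}"
        by (auto simp: typing_iff_sized sized_Lam_single_iff case_nat_eta)
      moreover have "\<not> is_value u"
        using normal_bal_shuf_root(1)[OF less.prems] by (auto simp: App Lam intro: beta_v.intros)
      then obtain \<Delta> where "\<Delta> \<turnstile> u : \<Gamma> 0"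
        using u_any by (auto simp: Lam intro: is_value.intros)
      ultimately have "\<exists>\<Gamma>. \<Gamma> \<turnstile> t : Q"
        unfolding App Lam using typing.app by blast
      then show ?thesis by (auto simp: App Lam)
    next
      case (App s1 s2)
      \<comment> \<open>By \<open>sigma1\<close>-normality \<open>s\<close> is not an applied
        abstraction, so it takes any type, in particular the arrow from the type of \<open>u\<close>
        to \<open>Q\<close>.\<close>
      have "\<nexists>s'. s1 = Lam s'"
        using normal_bal_shuf_root(2)[OF less.prems] by (auto simp: \<open>t = App s u\<close> App intro: sigma1.intros)
      then have "\<forall>Q. \<exists>\<Gamma>. \<Gamma> \<turnstile> s : Q"
        using IHs by (auto simp: \<open>t = App s u\<close> App elim: is_value.cases)
      moreover obtain P \<Gamma> where "\<Gamma> \<turnstile> u : P"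
        using IHu by (auto simp: \<open>t = App s u\<close>)
      ultimately have "\<exists>\<Gamma>. \<Gamma> \<turnstile> t : Q" for Q
        unfolding \<open>t = App s u\<close> using typing.app by blast
      then show ?thesis by blast
    qed
  qed
qed


section \<open>The characterization\<close>

lemma env_of_map:
  assumes "\<And>x. x \<notin> set xs \<Longrightarrow> \<Gamma> x = 0"
  shows "env_of xs (map \<Gamma> xs) = \<Gamma>"
  using assms by (auto simp: env_of_def fun_eq_iff map_of_zip_map)

lemma typable_iff_env_of:
  assumes "Fv t \<subseteq> set xs"
  shows "(\<exists>\<Gamma> Q. \<Gamma> \<turnstile> t : Q) \<longleftrightarrow> (\<exists>Ps Q. length Ps = length xs \<and> env_of xs Ps \<turnstile> t : Q)"
proof
  assume "\<exists>\<Gamma> Q. \<Gamma> \<turnstile> t : Q"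
  then obtain \<Gamma> Q where \<Gamma>: "\<Gamma> \<turnstile> t : Q" by blast
  then have "env_of xs (map \<Gamma> xs) = \<Gamma>"
    using assms by (intro env_of_map) (auto simp: typing_iff_sized dest: sized_eq_zero_outside_Fv)
  with \<Gamma> show "\<exists>Ps Q. length Ps = length xs \<and> env_of xs Ps \<turnstile> t : Q"
    by (metis length_map)
qed blast

lemma bal_shuf_imp_shuf: "bal_shuf t u \<Longrightarrow> shuf t u"
  by (auto simp: bal_shuf_def shuf_def elim!: bal_red.cases intro: red.intros)

lemma normalizable_imp_shuf_equiv_normal:
  assumes "normalizable bal_shuf t"
  shows "\<exists>u. normal bal_shuf u \<and> t \<simeq>\<^sub>s\<^sub>h\<^sub>u\<^sub>f u"
proof -
  obtain u where "bal_shuf\<^sup>*\<^sup>* t u" "normal bal_shuf u"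
    using assms by (auto simp: normalizable_def)
  moreover from this(1) have "t \<simeq>\<^sub>s\<^sub>h\<^sub>u\<^sub>f u"
    by induction (auto intro: equivclp_into_equivclp dest: bal_shuf_imp_shuf)
  ultimately show ?thesis by blast
qed

theorem mainTheorem1:
  fixes t :: trm and xs :: "nat list"
  assumes "distinct xs" and "Fv t \<subseteq> set xs"
  shows "(normalizable bal_shuf t \<longleftrightarrow> (\<exists>u. normal bal_shuf u \<and> t \<simeq>\<^sub>s\<^sub>h\<^sub>u\<^sub>f u)) \<and>
    ((\<exists>u. normal bal_shuf u \<and> t \<simeq>\<^sub>s\<^sub>h\<^sub>u\<^sub>f u) \<longleftrightarrow> sem xs t \<noteq> {}) \<and>
    (sem xs t \<noteq> {} \<longleftrightarrow> (\<exists>Ps Q. length Ps = length xs \<and> env_of xs Ps \<turnstile> t : Q)) \<and>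
    ((\<exists>Ps Q. length Ps = length xs \<and> env_of xs Ps \<turnstile> t : Q) \<longleftrightarrow> strongly_normalizable bal_shuf t)"
proof -
  \<comment> \<open>Typability in some environment links the conditions in a cycle: typable,
    strongly normalizable, normalizable, equivalent to a normal term, typable.\<close>
  let ?typable = "\<exists>\<Gamma> Q. \<Gamma> \<turnstile> t : Q"
  have sem: "sem xs t \<noteq> {} \<longleftrightarrow> (\<exists>Ps Q. length Ps = length xs \<and> env_of xs Ps \<turnstile> t : Q)"
    by (auto simp: sem_def)
  have "?typable" if "normal bal_shuf u" "t \<simeq>\<^sub>s\<^sub>h\<^sub>u\<^sub>f u" for u
    using normal_typable[OF that(1)] typing_shuf_equiv_iff[OF that(2)] by blast
  moreover have "?typable \<Longrightarrow> strongly_normalizable bal_shuf t"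
    using typing_strongly_normalizable by blast
  ultimately show ?thesis
    unfolding sem typable_iff_env_of[OF assms(2), symmetric]
    using strongly_normalizable_imp_normalizable normalizable_imp_shuf_equiv_normal by metis
qed

end
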